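(* For every $d\in\mathbb{N}$ there exists a constant $C_d>0$, depending only on $d$, such that the following holds. Let $p\geq 1$, $n\in\mathbb{N}$, and let $\mu=\mathrm{Uniform}(\tilde B_{p,n})$. Then for every homogeneous polynomial $f:\mathbb{R}^n\to\mathbb{R}$ of degree $d$, \[\mathbb{E}_\mu[f^2]\geq C_d\,\mathrm{coeff}_d^2(f).\]
   Context: $\|x\|_p=(\sum_{i=1}^n|x_i|^p)^{1/p}$ and $B_{p,n}=\{x\in\mathbb{R}^n:\|x\|_p\le 1\}$. The isotropic $L_p$ ball is $\tilde B_{p,n}=z_{p,n}B_{p,n}$, where $z_{p,n}>0$ is chosen so that the uniform probability measure on $\tilde B_{p,n}$ is isotropic (centered with identity covariance). For a polynomial $f(x)=\sum_{|I|\le d}\alpha_I x^I$ (multi-index notation), $\mathrm{coeff}_d(f)=\sqrt{\sum_{|I|=d}\alpha_I^2}$. *)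

theory Defs
  imports "HOL-Probability.Probability"
begin

text \<open>Points of R^n are represented as functions nat => real; only the
  coordinates 0..n-1 matter, and Lebesgue measure on R^n is the product
  measure of lborel over the index set {..<n} (carrier: extensional functions).\<close>

definition lebesgue_Rn :: "nat \<Rightarrow> (nat \<Rightarrow> real) measure" where
  "lebesgue_Rn n = (\<Pi>\<^sub>M i\<in>{..<n}. (lborel :: real measure))"

definition lp_norm :: "real \<Rightarrow> nat \<Rightarrow> (nat \<Rightarrow> real) \<Rightarrow> real" where
  "lp_norm p n x = (\<Sum>i<n. \<bar>x i\<bar> powr p) powr (1 / p)"

definition scaled_lp_ball :: "real \<Rightarrow> nat \<Rightarrow> real \<Rightarrow> (nat \<Rightarrow> real) set" where
  "scaled_lp_ball p n z = {x \<in> space (lebesgue_Rn n). lp_norm p n x \<le> z}"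

definition unif_ball :: "real \<Rightarrow> nat \<Rightarrow> real \<Rightarrow> (nat \<Rightarrow> real) measure" where
  "unif_ball p n z = uniform_measure (lebesgue_Rn n) (scaled_lp_ball p n z)"

definition isotropic :: "nat \<Rightarrow> (nat \<Rightarrow> real) measure \<Rightarrow> bool" where
  "isotropic n M \<longleftrightarrow>
     (\<forall>i<n. integrable M (\<lambda>x. x i) \<and> (\<integral>x. x i \<partial>M) = 0) \<and>
     (\<forall>i<n. \<forall>j<n. integrable M (\<lambda>x. x i * x j) \<and>
        (\<integral>x. x i * x j \<partial>M) = (if i = j then 1 else 0))"

definition multi_idx :: "nat \<Rightarrow> nat \<Rightarrow> (nat \<Rightarrow> nat) set" where
  "multi_idx n d = {I. (\<forall>i\<ge>n. I i = 0) \<and> (\<Sum>i<n. I i) = d}"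

definition hom_poly :: "nat \<Rightarrow> nat \<Rightarrow> ((nat \<Rightarrow> nat) \<Rightarrow> real) \<Rightarrow> (nat \<Rightarrow> real) \<Rightarrow> real" where
  "hom_poly n d \<alpha> x = (\<Sum>I\<in>multi_idx n d. \<alpha> I * (\<Prod>i<n. x i ^ I i))"

definition coeff_sq :: "nat \<Rightarrow> nat \<Rightarrow> ((nat \<Rightarrow> nat) \<Rightarrow> real) \<Rightarrow> real" where
  "coeff_sq n d \<alpha> = (\<Sum>I\<in>multi_idx n d. (\<alpha> I)\<^sup>2)"

end

theory Submission
  imports Defs
begin

text \<open>Let \<open>Y\<close> have independent coordinates with density proportional to \<open>exp (-\<bar>y\<bar> powr p)\<close>.
  Integrating in shells, \<open>E f(Y)\<^sup>2\<close> is a ratio of Gamma values times the average of \<open>f\<^sup>2\<close> over the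
  ball, because \<open>f\<^sup>2\<close> is homogeneous. In \<open>L\<^sup>2\<close> of the law of \<open>Y\<close> one has
  \<open>E f(Y)\<^sup>2 \<ge> \<Sum>\<^sub>I \<alpha>\<^sub>I\<^sup>2 \<Prod>\<^sub>i \<parallel>h\<^bsub>I i\<^esub>\<parallel>\<^sup>2\<close>, where \<open>h\<^sub>k\<close> are the monic orthogonal polynomials of one
  coordinate; here \<open>h\<^sub>0 = 1\<close>, and for \<open>1 \<le> k \<le> d\<close> the norm of \<open>h\<^sub>k\<close> is at least a constant times
  the \<open>k\<close>-th power of the standard deviation, uniformly in \<open>p\<close>. Isotropy fixes the scale of the ball
  through the second moment of one coordinate, and the resulting quotient of Gamma values is
  bounded by a reverse form of log-convexity.\<close>

section \<open>Monic polynomials on an interval\<close>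

lemma degree_coeff_poly_difference:
  fixes q :: "real poly"
  assumes "degree q \<le> Suc k"
  shows "degree (pcompose q [:h, 1:] - q) \<le> k \<and>
    coeff (pcompose q [:h, 1:] - q) k = real (Suc k) * h * coeff q (Suc k)"
  using assms
proof (induction q arbitrary: k)
  case 0
  then show ?case by simp
next
  case (pCons a q)
  define D where "D = pcompose q [:h, 1:] - q"
  have step: "pcompose (pCons a q) [:h, 1:] - pCons a q = pCons 0 D + smult h (q + D)"
    by (simp add: D_def pcompose_pCons algebra_simps)
  have deg: "degree q \<le> k"
    using pCons.prems by (cases "q = 0") auto
  show ?case
  proof (cases k)
    case 0
    then obtain c where "q = [:c:]"
      using deg by (metis degree_eq_zeroE le_zero_eq)
    then show ?thesis
      by (simp add: step D_def 0 pcompose_pCons)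
  next
    case (Suc m)
    have IH: "degree D \<le> m" "coeff D m = real (Suc m) * h * coeff q (Suc m)"
      using pCons.IH[of m] deg unfolding D_def Suc by auto
    have "degree (pCons 0 D) \<le> k"
      using IH(1) Suc order.trans[OF degree_pCons_le[of 0 D], of k] by simp
    moreover have "degree (smult h (q + D)) \<le> k"
      using IH(1) deg Suc by (intro order.trans[OF degree_smult_le] degree_add_le) auto
    ultimately have "degree (pCons 0 D + smult h (q + D)) \<le> k"
      by (rule degree_add_le)
    moreover have "coeff D k = 0"
      using IH(1) Suc by (intro coeff_eq_0) auto
    ultimately show ?thesis
      unfolding step using IH(2) Suc by (simp add: algebra_simps)
  qed
qed

text \<open>Taking a forward difference trades one degree for a translate of the interval.\<close>
lemma poly_L2_lower_bound:
  fixes L :: real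
  assumes "L > 0"
  shows "\<exists>\<beta>>0. \<forall>a q. degree q \<le> k \<longrightarrow>
    \<beta> * (coeff q k)\<^sup>2 \<le> integral {a..a+L} (\<lambda>x. (poly q x)\<^sup>2)"
  using assms
proof (induction k arbitrary: L)
  case 0
  show ?case
  proof (intro exI[of _ L] conjI allI impI)
    fix a and q :: "real poly"
    assume "degree q \<le> 0"
    then obtain c where "q = [:c:]" by (metis degree_eq_zeroE le_zero_eq)
    then show "L * (coeff q 0)\<^sup>2 \<le> integral {a..a+L} (\<lambda>x. (poly q x)\<^sup>2)"
      using 0 by simp
  qed fact
next
  case (Suc k)
  define h where "h = L / 2"
  have h: "h > 0" "L = h + h" using Suc.prems by (auto simp: h_def)
  obtain \<beta> where \<beta>: "\<beta> > 0" "\<And>a q. degree q \<le> k \<Longrightarrow>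
      \<beta> * (coeff q k)\<^sup>2 \<le> integral {a..a+h} (\<lambda>x. (poly q x)\<^sup>2)"
    using Suc.IH[OF h(1)] by blast
  show ?case
  proof (intro exI[of _ "\<beta> * (real (Suc k) * h)\<^sup>2 / 4"] conjI allI impI)
    show "\<beta> * (real (Suc k) * h)\<^sup>2 / 4 > 0" using \<beta>(1) h by simp
  next
    fix a :: real and q :: "real poly"
    assume deg: "degree q \<le> Suc k"
    define D where "D = pcompose q [:h, 1:] - q"
    note D = degree_coeff_poly_difference[OF deg, of h, folded D_def]
    have io: "(\<lambda>x. (poly q (x + c))\<^sup>2) integrable_on {u..v}" for c u v
      by (intro integrable_continuous_interval continuous_intros)
    have io0: "(\<lambda>x. (poly q x)\<^sup>2) integrable_on {u..v}" for u v
      by (intro integrable_continuous_interval continuous_intros)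
    have shift: "integral {a..a+h} (\<lambda>x. (poly q (x + h))\<^sup>2) =
        integral {a+h..a+L} (\<lambda>x. (poly q x)\<^sup>2)"
      using integral_shift_Icc_real[of a "a+h" "\<lambda>x. (poly q x)\<^sup>2" h] h
      by (simp add: o_def add_ac continuous_intros)
    have "\<beta> * (real (Suc k) * h * coeff q (Suc k))\<^sup>2 \<le> integral {a..a+h} (\<lambda>x. (poly D x)\<^sup>2)"
      using \<beta>(2)[of D a] D by auto
    also have "\<dots> \<le> integral {a..a+h} (\<lambda>x. 2 * (poly q (x + h))\<^sup>2 + 2 * (poly q x)\<^sup>2)"
    proof (rule integral_le)
      show "(\<lambda>x. (poly D x)\<^sup>2) integrable_on {a..a + h}"
        by (intro integrable_continuous_interval continuous_intros)
      show "(\<lambda>x. 2 * (poly q (x + h))\<^sup>2 + 2 * (poly q x)\<^sup>2) integrable_on {a..a + h}"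
        by (intro integrable_continuous_interval continuous_intros)
      fix x
      have "(poly D x)\<^sup>2 = (poly q (x + h) - poly q x)\<^sup>2"
        by (simp add: D_def poly_pcompose add.commute)
      also have "\<dots> \<le> 2 * (poly q (x + h))\<^sup>2 + 2 * (poly q x)\<^sup>2"
        using zero_le_power2[of "poly q (x + h) + poly q x"]
        by (simp add: power2_sum power2_diff)
      finally show "(poly D x)\<^sup>2 \<le> 2 * (poly q (x + h))\<^sup>2 + 2 * (poly q x)\<^sup>2" .
    qed
    also have "\<dots> = 2 * integral {a..a+h} (\<lambda>x. (poly q (x + h))\<^sup>2)
        + 2 * integral {a..a+h} (\<lambda>x. (poly q x)\<^sup>2)"
      using io io0
      by (subst integral_add) (auto intro!: integrable_on_cmult_left)
    also have "\<dots> = 2 * integral {a..a+L} (\<lambda>x. (poly q x)\<^sup>2)"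
      unfolding shift
      using Henstock_Kurzweil_Integration.integral_combine[of a "a+h" "a+L" "\<lambda>x. (poly q x)\<^sup>2"] io0 h by simp
    also have "\<dots> \<le> 4 * integral {a..a+L} (\<lambda>x. (poly q x)\<^sup>2)"
      using integral_nonneg[OF io0[of a "a+L"]] by simp
    finally show "\<beta> * (real (Suc k) * h)\<^sup>2 / 4 * (coeff q (Suc k))\<^sup>2
        \<le> integral {a..a+L} (\<lambda>x. (poly q x)\<^sup>2)"
      by (simp add: power_mult_distrib)
  qed
qed

section \<open>Orthogonal polynomials in one variable\<close>

definition exp_pow :: "real \<Rightarrow> real \<Rightarrow> real" where
  "exp_pow p y = exp (- (\<bar>y\<bar> powr p))"

lemma exp_pow_pos: "exp_pow p y > 0"
  by (simp add: exp_pow_def)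

lemma exp_pow_measurable [measurable]: "exp_pow p \<in> borel_measurable borel"
  unfolding exp_pow_def by measurable

lemma exp_pow_le: "p \<ge> 1 \<Longrightarrow> exp_pow p y \<le> exp 1 * exp (- \<bar>y\<bar>)"
proof -
  assume p: "p \<ge> 1"
  have "\<bar>y\<bar> - 1 \<le> \<bar>y\<bar> powr p"
  proof (cases "\<bar>y\<bar> \<ge> 1")
    case True
    then show ?thesis using powr_mono[OF p, of "\<bar>y\<bar>"] by simp
  next
    case False
    then show ?thesis by (smt (verit) powr_ge_zero)
  qed
  then show ?thesis by (simp add: exp_pow_def flip: exp_add)
qed

lemma exp_pow_ge: "p \<ge> 1 \<Longrightarrow> \<bar>y\<bar> \<le> 1 \<Longrightarrow> exp (- 1) \<le> exp_pow p y"
  using powr_le1[of p "\<bar>y\<bar>"] by (simp add: exp_pow_def)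

lemma nn_integral_abs_power_times_exp:
  "(\<integral>\<^sup>+(x::real). ennreal (\<bar>x\<bar> ^ k * exp (-\<bar>x\<bar>)) \<partial>lborel) = ennreal (2 * fact k)"
proof -
  let ?f = "\<lambda>x::real. ennreal (\<bar>x\<bar> ^ k * exp (-\<bar>x\<bar>))"
  have pos: "(\<integral>\<^sup>+x. ?f x * indicator {0..} x \<partial>lborel) = ennreal (fact k)"
  proof -
    have "(\<integral>\<^sup>+x. ?f x * indicator {0..} x \<partial>lborel) =
        (\<integral>\<^sup>+x. ennreal (x ^ k * exp (-x)) * indicator {0 ..} x \<partial>lborel)"
      by (intro nn_integral_cong) (auto split: split_indicator)
    then show ?thesis by (simp add: nn_intergal_power_times_exp_Ici)
  qed
  have neg: "(\<integral>\<^sup>+x. ?f x * indicator {..0} x \<partial>lborel) = ennreal (fact k)"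
  proof -
    have "(\<integral>\<^sup>+x. ?f x * indicator {..0} x \<partial>lborel) =
        (\<integral>\<^sup>+x. ?f x * indicator {0..} x \<partial>lborel)"
      by (subst nn_integral_real_affine[of _ "-1" 0])
        (auto intro!: nn_integral_cong split: split_indicator)
    then show ?thesis by (simp add: pos)
  qed
  have "AE x in lborel. ?f x = ?f x * indicator {..0} x + ?f x * indicator {0..} x"
    using AE_lborel_singleton[of "0::real"] by eventually_elim (auto split: split_indicator)
  then have "(\<integral>\<^sup>+x. ?f x \<partial>lborel) =
      (\<integral>\<^sup>+x. (?f x * indicator {..0} x + ?f x * indicator {0..} x) \<partial>lborel)"
    by (rule nn_integral_cong_AE)
  also have "\<dots> = ennreal (fact k) + ennreal (fact k)"
    by (subst nn_integral_add) (simp_all only: pos neg, measurable)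
  finally show ?thesis
    by (simp flip: ennreal_plus)
qed

lemma
  shows integrable_abs_power_times_exp: "integrable lborel (\<lambda>x::real. \<bar>x\<bar> ^ k * exp (-\<bar>x\<bar>))"
    and integral_abs_power_times_exp: "(\<integral>(x::real). \<bar>x\<bar> ^ k * exp (-\<bar>x\<bar>) \<partial>lborel) = 2 * fact k"
  using nn_integral_eq_integrable[of "\<lambda>x::real. \<bar>x\<bar> ^ k * exp (-\<bar>x\<bar>)" lborel "2 * fact k"]
    nn_integral_abs_power_times_exp[of k] by auto

lemma integrable_power_exp_pow:
  assumes "p \<ge> 1"
  shows "integrable lborel (\<lambda>y. y ^ k * exp_pow p y)"
proof (rule Bochner_Integration.integrable_bound)
  show "integrable lborel (\<lambda>y::real. exp 1 * (\<bar>y\<bar> ^ k * exp (-\<bar>y\<bar>)))"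
    using integrable_abs_power_times_exp by simp
  show "AE y in lborel. norm (y ^ k * exp_pow p y) \<le> norm (exp 1 * (\<bar>y\<bar> ^ k * exp (- \<bar>y\<bar>)))"
  proof (rule AE_I2)
    fix y :: real
    show "norm (y ^ k * exp_pow p y) \<le> norm (exp 1 * (\<bar>y\<bar> ^ k * exp (- \<bar>y\<bar>)))"
      using mult_left_mono[OF exp_pow_le[OF assms, of y], of "\<bar>y\<bar> ^ k"] exp_pow_pos[of p y]
      by (simp add: abs_mult power_abs mult_ac)
  qed
qed simp

lemma integrable_poly_exp_pow:
  assumes "p \<ge> 1"
  shows "integrable lborel (\<lambda>y. poly q y * exp_pow p y)"
  unfolding poly_altdef sum_distrib_right
  using integrable_power_exp_pow[OF assms]
  by (intro Bochner_Integration.integrable_sum) (auto simp: mult.assoc)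

definition mass :: "real \<Rightarrow> real" where
  "mass p = (\<integral>y. exp_pow p y \<partial>lborel)"

definition second_moment :: "real \<Rightarrow> real" where
  "second_moment p = (\<integral>y. y\<^sup>2 * exp_pow p y \<partial>lborel)"

definition inner_w :: "real \<Rightarrow> real poly \<Rightarrow> real poly \<Rightarrow> real" where
  "inner_w p q r = (\<integral>y. poly q y * poly r y * exp_pow p y \<partial>lborel)"

lemma integrable_inner_w:
  "p \<ge> 1 \<Longrightarrow> integrable lborel (\<lambda>y. poly q y * poly r y * exp_pow p y)"
  using integrable_poly_exp_pow[of p "q * r"] by simp

lemma inner_w_commute: "inner_w p q r = inner_w p r q"
  by (simp add: inner_w_def mult.commute)

lemma inner_w_simps:
  assumes "p \<ge> 1"
  shows "inner_w p (q + r) s = inner_w p q s + inner_w p r s"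
    "inner_w p (q - r) s = inner_w p q s - inner_w p r s"
    "inner_w p (smult c q) s = c * inner_w p q s"
    "inner_w p s (q + r) = inner_w p s q + inner_w p s r"
    "inner_w p s (q - r) = inner_w p s q - inner_w p s r"
    "inner_w p s (smult c q) = c * inner_w p s q"
proof -
  note i = integrable_inner_w[OF assms]
  show 1: "inner_w p (q + r) s = inner_w p q s + inner_w p r s" for q r s
    using Bochner_Integration.integral_add[OF i[of q s] i[of r s]]
    by (simp add: inner_w_def distrib_right)
  show 2: "inner_w p (q - r) s = inner_w p q s - inner_w p r s" for q r s
    using Bochner_Integration.integral_diff[OF i[of q s] i[of r s]]
    by (simp add: inner_w_def left_diff_distrib)
  show 3: "inner_w p (smult c q) s = c * inner_w p q s" for q s
    by (simp add: inner_w_def mult.assoc)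
  show "inner_w p s (q + r) = inner_w p s q + inner_w p s r"
    "inner_w p s (q - r) = inner_w p s q - inner_w p s r"
    "inner_w p s (smult c q) = c * inner_w p s q"
    using 1 2 3 by (simp_all add: inner_w_commute[of p s])
qed

lemma inner_w_ge:
  assumes "p \<ge> 1"
  shows "exp (-1) * integral {-1..1} (\<lambda>y. (poly q y)\<^sup>2) \<le> inner_w p q q"
proof -
  have si: "set_integrable lborel {-1..1} (\<lambda>y. (poly q y)\<^sup>2)"
    by (intro borel_integrable_atLeastAtMost' continuous_intros)
  then have "integral {-1..1} (\<lambda>y. (poly q y)\<^sup>2) =
      (\<integral>y. indicator {-1..1} y * (poly q y)\<^sup>2 \<partial>lborel)"
    using set_borel_integral_eq_integral(2)[OF si] by (simp add: set_lebesgue_integral_def)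
  moreover have "exp (-1) * (\<integral>y. indicator {-1..1} y * (poly q y)\<^sup>2 \<partial>lborel) \<le> inner_w p q q"
    unfolding inner_w_def
  proof (subst integral_mult_right_zero[symmetric], rule integral_mono)
    show "integrable lborel (\<lambda>y. exp (-1) * (indicator {-1..1} y * (poly q y)\<^sup>2))"
      using si by (simp add: set_integrable_def)
    show "integrable lborel (\<lambda>y. poly q y * poly q y * exp_pow p y)"
      using assms by (rule integrable_inner_w)
    fix y
    show "exp (-1) * (indicator {-1..1} y * (poly q y)\<^sup>2) \<le> poly q y * poly q y * exp_pow p y"
      using mult_right_mono[OF exp_pow_ge[OF assms, of y], of "(poly q y)\<^sup>2"]
        mult_nonneg_nonneg[OF zero_le_power2[of "poly q y"] less_imp_le[OF exp_pow_pos[of p y]]]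
      by (auto simp: indicator_def power2_eq_square mult_ac abs_le_iff)
  qed
  ultimately show ?thesis by simp
qed

lemma mass_bounds:
  assumes "p \<ge> 1"
  shows "2 * exp (-1) \<le> mass p" "mass p \<le> 2 * exp 1"
proof -
  have "integral {-1..1} (\<lambda>y::real. 1::real) = 2" by simp
  then show "2 * exp (-1) \<le> mass p"
    using inner_w_ge[OF assms, of 1] by (simp add: inner_w_def mass_def)
  have "mass p \<le> (\<integral>y. exp 1 * (\<bar>y\<bar> ^ 0 * exp (-\<bar>y\<bar>)) \<partial>lborel)"
    unfolding mass_def
    using exp_pow_le[OF assms] integrable_power_exp_pow[OF assms, of 0] integrable_abs_power_times_exp[of 0]
    by (intro integral_mono) simp_all
  also have "\<dots> = 2 * exp 1"
    using integral_abs_power_times_exp[of 0] by simp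
  finally show "mass p \<le> 2 * exp 1" .
qed

lemma mass_pos: "p \<ge> 1 \<Longrightarrow> mass p > 0"
  using mass_bounds(1)[of p] exp_gt_zero[of "-1::real"] by linarith

lemma second_moment_bounds:
  assumes "p \<ge> 1"
  shows "0 \<le> second_moment p" "second_moment p \<le> 4 * exp 1"
proof -
  show "0 \<le> second_moment p"
    unfolding second_moment_def using exp_pow_pos[of p]
    by (intro integral_nonneg_AE AE_I2) (simp add: less_imp_le)
  have "second_moment p \<le> (\<integral>y. exp 1 * (\<bar>y\<bar> ^ 2 * exp (-\<bar>y\<bar>)) \<partial>lborel)"
    unfolding second_moment_def
  proof (rule integral_mono)
    fix y :: real
    show "y\<^sup>2 * exp_pow p y \<le> exp 1 * (\<bar>y\<bar> ^ 2 * exp (- \<bar>y\<bar>))"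
      using mult_left_mono[OF exp_pow_le[OF assms, of y], of "y\<^sup>2"] by (simp add: mult_ac)
  qed (use integrable_power_exp_pow[OF assms] integrable_abs_power_times_exp[of 2] in simp_all)
  also have "\<dots> = 4 * exp 1"
    using integral_abs_power_times_exp[of 2] by (simp del: power2_abs)
  finally show "second_moment p \<le> 4 * exp 1" .
qed

text \<open>The factor \<open>c ^ k\<close> leaves the degree \<open>0\<close> case sharp, which keeps products over
  arbitrarily many variables under control.\<close>
lemma inner_w_monic_lower_bound:
  "\<exists>c>0. \<forall>p\<ge>1. \<forall>k\<le>d. \<forall>q. degree q = k \<longrightarrow> lead_coeff q = 1 \<longrightarrow>
     mass p * (c * (second_moment p / mass p)) ^ k \<le> inner_w p q q"
proof -
  have "\<forall>k. \<exists>\<beta>>0. \<forall>a q. degree q \<le> k \<longrightarrow>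
      \<beta> * (coeff q k)\<^sup>2 \<le> integral {a..a+2::real} (\<lambda>x. (poly q x)\<^sup>2)"
    using poly_L2_lower_bound[of 2] by simp
  then obtain \<beta> where \<beta>: "\<And>k. \<beta> k > 0" "\<And>k a q. degree q \<le> k \<Longrightarrow>
      \<beta> k * (coeff q k)\<^sup>2 \<le> integral {a..a+2::real} (\<lambda>x. (poly q x)\<^sup>2)"
    by metis
  define M :: real where "M = 2 * exp 1 * exp 1"
  have M: "M > 0" by (simp add: M_def)
  define c where "c = Min (insert 1 ((\<lambda>k. exp (-1) * \<beta> k / (2 * exp 1 * M ^ k)) ` {..d}))"
  have c: "c > 0" "c \<le> 1"
    using \<beta>(1) M unfolding c_def by (subst Min_gr_iff; simp; fail) (rule Min_le; simp)
  have c': "c \<le> exp (-1) * \<beta> k / (2 * exp 1 * M ^ k)" if "k \<le> d" for k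
    unfolding c_def by (rule Min_le) (use that in auto)
  show ?thesis
  proof (intro exI[of _ c] conjI allI impI)
    fix p :: real and k :: nat and q :: "real poly"
    assume p: "p \<ge> 1" and k: "k \<le> d" and deg: "degree q = k" and lead: "lead_coeff q = 1"
    note mb = mass_bounds[OF p] and sb = second_moment_bounds[OF p]
    have mp: "mass p > 0" by (rule mass_pos[OF p])
    show "mass p * (c * (second_moment p / mass p)) ^ k \<le> inner_w p q q"
    proof (cases k)
      case 0
      then obtain a where "q = [:a:]" using deg by (metis degree_eq_zeroE)
      then show ?thesis using lead 0 by (simp add: inner_w_def mass_def)
    next
      case (Suc m)
      have "second_moment p / mass p \<le> 4 * exp 1 / (2 * exp (-1))"
        using mb(1) sb by (intro frac_le) auto
      also have "\<dots> = M" by (simp add: M_def exp_minus field_simps)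
      finally have r: "second_moment p / mass p \<le> M" .
      have "mass p * (c * (second_moment p / mass p)) ^ k \<le> 2 * exp 1 * (c ^ k * M ^ k)"
        unfolding power_mult_distrib[of c]
        using mb mp sb c r by (intro mult_mono power_mono) auto
      also have "c ^ k \<le> c ^ 1"
        using c Suc by (intro power_decreasing) auto
      then have "2 * exp 1 * (c ^ k * M ^ k) \<le> 2 * exp 1 * (c * M ^ k)"
        using M by simp
      also have "\<dots> \<le> exp (-1) * \<beta> k"
        using c'[OF k] M by (simp add: field_simps)
      also have "\<dots> \<le> exp (-1) * integral {-1..1} (\<lambda>y. (poly q y)\<^sup>2)"
        using \<beta>(2)[of q k "-1"] deg lead by simp
      also have "\<dots> \<le> inner_w p q q" by (rule inner_w_ge[OF p])
      finally show ?thesis .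
    qed
  qed fact
qed

lemma inner_w_monic_pos:
  assumes "p \<ge> 1" "lead_coeff q = 1"
  shows "inner_w p q q > 0"
proof -
  obtain \<beta> where "\<beta> > 0" "\<And>a r. degree r \<le> degree q \<Longrightarrow>
      \<beta> * (coeff r (degree q))\<^sup>2 \<le> integral {a..a+2::real} (\<lambda>x. (poly r x)\<^sup>2)"
    using poly_L2_lower_bound[of 2 "degree q"] by auto
  from this(1) this(2)[of q "-1"] have "integral {-1..1} (\<lambda>x. (poly q x)\<^sup>2) > 0"
    using assms by simp
  then have "0 < exp (-1) * integral {-1..1} (\<lambda>x. (poly q x)\<^sup>2)" by simp
  with inner_w_ge[OF assms(1), of q] show ?thesis by linarith
qed

lemma exists_projection:
  assumes p: "p \<ge> 1"
  shows "\<exists>s. (\<forall>i\<ge>k. coeff s i = 0) \<and> (\<forall>t. (\<forall>i\<ge>k. coeff t i = 0) \<longrightarrow> inner_w p (r - s) t = 0)"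
proof (induction k arbitrary: r)
  case 0
  have "inner_w p (r - 0) t = 0" if "\<forall>i. coeff t i = 0" for t
  proof -
    have "t = 0" using that by (simp add: poly_eq_iff)
    then show ?thesis by (simp add: inner_w_def)
  qed
  then show ?case by (intro exI[of _ 0]) auto
next
  case (Suc k)
  obtain m where m: "\<And>i. i \<ge> k \<Longrightarrow> coeff m i = 0"
    "\<And>t. \<forall>i\<ge>k. coeff t i = 0 \<Longrightarrow> inner_w p (monom 1 k - m) t = 0"
    using Suc by metis
  define h where "h = monom 1 k - m"
  have h: "coeff h k = 1" "\<And>i. i > k \<Longrightarrow> coeff h i = 0"
    using m(1) by (auto simp: h_def)
  then have "degree h = k"
    by (intro antisym degree_le le_degree) auto
  then have hh: "inner_w p h h > 0"
    using h by (intro inner_w_monic_pos[OF p]) auto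
  obtain s where s: "\<And>i. i \<ge> k \<Longrightarrow> coeff s i = 0"
    "\<And>t. \<forall>i\<ge>k. coeff t i = 0 \<Longrightarrow> inner_w p (r - s) t = 0"
    using Suc by metis
  define s' where "s' = s + smult (inner_w p (r - s) h / inner_w p h h) h"
  show ?case
  proof (intro exI[of _ s'] conjI allI impI)
    fix i assume "i \<ge> Suc k"
    then show "coeff s' i = 0" using s(1)[of i] h(2)[of i] by (simp add: s'_def)
  next
    fix t :: "real poly" assume t: "\<forall>i\<ge>Suc k. coeff t i = 0"
    define u where "u = t - smult (coeff t k) h"
    have u: "coeff u i = 0" if "i \<ge> k" for i
      using that t h by (cases "i = k") (auto simp: u_def)
    define e where "e = r - s"
    define b where "b = inner_w p e h / inner_w p h h"
    have t_eq: "t = u + smult (coeff t k) h" by (simp add: u_def)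
    have r_eq: "r - s' = e - smult b h"
      by (simp add: s'_def b_def e_def)
    have "inner_w p e u = 0" "inner_w p h u = 0"
      using s(2)[of u] m(2)[of u] u by (auto simp: h_def e_def)
    moreover have "b * inner_w p h h = inner_w p e h"
      using hh by (simp add: b_def)
    ultimately show "inner_w p (r - s') t = 0"
      unfolding r_eq by (subst t_eq) (simp add: inner_w_simps[OF p])
  qed
qed

lemma exists_orthogonal_poly:
  assumes p: "p \<ge> 1"
  shows "\<exists>h. degree h = k \<and> lead_coeff h = 1 \<and> (\<forall>t. degree t < k \<longrightarrow> inner_w p h t = 0)"
proof -
  obtain s where s: "\<And>i. i \<ge> k \<Longrightarrow> coeff s i = 0"
    "\<And>t. \<forall>i\<ge>k. coeff t i = 0 \<Longrightarrow> inner_w p (monom 1 k - s) t = 0"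
    using exists_projection[OF p, of k "monom 1 k"] by blast
  have "degree (monom 1 k - s) = k"
    using s(1) by (intro antisym degree_le le_degree) auto
  moreover have "coeff (monom 1 k - s) k = 1" using s(1) by simp
  moreover have "\<forall>i\<ge>k. coeff t i = 0" if "degree t < k" for t :: "real poly"
    using that by (simp add: coeff_eq_0)
  ultimately show ?thesis using s(2) by (intro exI[of _ "monom 1 k - s"]) auto
qed

section \<open>Product weights\<close>

definition weight_Rn :: "real \<Rightarrow> nat \<Rightarrow> (nat \<Rightarrow> real) \<Rightarrow> real" where
  "weight_Rn p n x = (\<Prod>i<n. exp_pow p (x i))"

definition prod_poly :: "nat \<Rightarrow> (nat \<Rightarrow> real poly) \<Rightarrow> (nat \<Rightarrow> real) \<Rightarrow> real" where
  "prod_poly n F x = (\<Prod>i<n. poly (F i) (x i))"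

interpretation lborel_product: product_sigma_finite "\<lambda>_::nat. lborel :: real measure"
  by standard

lemma
  assumes "p \<ge> 1"
  shows integrable_prod_poly:
      "integrable (lebesgue_Rn n) (\<lambda>x. prod_poly n F x * prod_poly n G x * weight_Rn p n x)"
    and integral_prod_poly:
      "(\<integral>x. prod_poly n F x * prod_poly n G x * weight_Rn p n x \<partial>lebesgue_Rn n) =
        (\<Prod>i<n. inner_w p (F i) (G i))"
proof -
  have eq: "prod_poly n F x * prod_poly n G x * weight_Rn p n x =
      (\<Prod>i<n. poly (F i) (x i) * poly (G i) (x i) * exp_pow p (x i))" for x
    by (simp add: prod_poly_def weight_Rn_def prod.distrib)
  show "integrable (lebesgue_Rn n) (\<lambda>x. prod_poly n F x * prod_poly n G x * weight_Rn p n x)"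
    unfolding eq lebesgue_Rn_def using integrable_inner_w[OF assms]
    by (intro lborel_product.product_integrable_prod) auto
  show "(\<integral>x. prod_poly n F x * prod_poly n G x * weight_Rn p n x \<partial>lebesgue_Rn n) =
      (\<Prod>i<n. inner_w p (F i) (G i))"
    unfolding eq lebesgue_Rn_def inner_w_def using integrable_inner_w[OF assms]
    by (intro lborel_product.product_integral_prod) auto
qed

lemma
  fixes F G :: "'a \<Rightarrow> nat \<Rightarrow> real poly" and \<alpha> \<beta> :: "'a \<Rightarrow> real"
    and A :: "'a set" and n :: nat
  assumes p: "p \<ge> 1"
  defines "u \<equiv> \<lambda>x. \<Sum>I\<in>A. \<alpha> I * prod_poly n (F I) x"
  defines "v \<equiv> \<lambda>x. \<Sum>J\<in>A. \<beta> J * prod_poly n (G J) x"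
  shows integrable_sum_prod_poly:
      "integrable (lebesgue_Rn n) (\<lambda>x. u x * v x * weight_Rn p n x)"
    and integral_sum_prod_poly:
      "(\<integral>x. u x * v x * weight_Rn p n x \<partial>lebesgue_Rn n) =
        (\<Sum>I\<in>A. \<Sum>J\<in>A. \<alpha> I * \<beta> J * (\<Prod>i<n. inner_w p (F I i) (G J i)))"
proof -
  have eq: "u x * v x * weight_Rn p n x = (\<Sum>I\<in>A. \<Sum>J\<in>A. \<alpha> I * \<beta> J *
      (prod_poly n (F I) x * prod_poly n (G J) x * weight_Rn p n x))" for x
    unfolding u_def v_def sum_product by (simp add: sum_distrib_right sum_distrib_left mult_ac)
  note i = integrable_prod_poly[OF p]
  show "integrable (lebesgue_Rn n) (\<lambda>x. u x * v x * weight_Rn p n x)"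
    unfolding eq by (intro Bochner_Integration.integrable_sum integrable_mult_right i)
  show "(\<integral>x. u x * v x * weight_Rn p n x \<partial>lebesgue_Rn n) =
      (\<Sum>I\<in>A. \<Sum>J\<in>A. \<alpha> I * \<beta> J * (\<Prod>i<n. inner_w p (F I i) (G J i)))"
    unfolding eq
    by (subst Bochner_Integration.integral_sum,
        intro Bochner_Integration.integrable_sum integrable_mult_right i,
        subst Bochner_Integration.integral_sum, intro integrable_mult_right i)
      (simp add: integral_prod_poly[OF p])
qed

lemma finite_multi_idx: "finite (multi_idx n d)"
proof (rule finite_subset)
  show "multi_idx n d \<subseteq>
      {I. \<forall>i. (i \<in> {..<n} \<longrightarrow> I i \<in> {..d}) \<and> (i \<notin> {..<n} \<longrightarrow> I i = 0)}"
  proof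
    fix I assume I: "I \<in> multi_idx n d"
    have "I i \<le> d" if "i < n" for i
      using member_le_sum[of i "{..<n}" I] that I by (simp add: multi_idx_def)
    then show "I \<in> {I. \<forall>i. (i \<in> {..<n} \<longrightarrow> I i \<in> {..d}) \<and> (i \<notin> {..<n} \<longrightarrow> I i = 0)}"
      using I by (simp add: multi_idx_def)
  qed
  show "finite {I :: nat \<Rightarrow> nat. \<forall>i. (i \<in> {..<n} \<longrightarrow> I i \<in> {..d}) \<and> (i \<notin> {..<n} \<longrightarrow> I i = 0)}"
    by (intro finite_set_of_finite_funs) auto
qed

lemma multi_idx_neq_less:
  assumes "I \<in> multi_idx n d" "J \<in> multi_idx n d" "I \<noteq> J"
  shows "\<exists>i<n. I i < J i"
proof (rule ccontr)
  assume "\<not> ?thesis"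
  then have le: "\<And>i. i < n \<Longrightarrow> J i \<le> I i" by (meson not_less)
  have "(\<Sum>i<n. J i) = (\<Sum>i<n. I i)" using assms by (simp add: multi_idx_def)
  then have "J i = I i" if "i < n" for i
    using sum_mono_inv[of J "{..<n}" I i] le that by auto
  then have "I = J"
    using assms by (auto simp: multi_idx_def fun_eq_iff) (metis not_less)
  with assms show False by simp
qed

lemma hom_poly_eq_prod_poly:
  "hom_poly n d \<alpha> x = (\<Sum>I\<in>multi_idx n d. \<alpha> I * prod_poly n (\<lambda>i. monom 1 (I i)) x)"
  by (simp add: hom_poly_def prod_poly_def poly_monom)

lemma integrable_hom_poly_square:
  assumes "p \<ge> 1"
  shows "integrable (lebesgue_Rn n) (\<lambda>x. (hom_poly n d \<alpha> x)\<^sup>2 * weight_Rn p n x)"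
  unfolding hom_poly_eq_prod_poly power2_eq_square by (rule integrable_sum_prod_poly[OF assms])

text \<open>Replacing each monomial of \<open>f\<close> by the product of the corresponding orthogonal polynomials
  gives \<open>g\<close> with \<open>\<langle>f, g\<rangle> = \<langle>g, g\<rangle>\<close>, so the bound is \<open>\<parallel>f - g\<parallel>\<^sup>2 \<ge> 0\<close>.\<close>
lemma hom_poly_orthogonal_lower_bound:
  assumes p: "p \<ge> 1"
    and h: "\<And>k. degree (h k) = k" "\<And>k. lead_coeff (h k) = 1"
    and orth: "\<And>k t. degree t < k \<Longrightarrow> inner_w p (h k) t = 0"
  shows "(\<Sum>I\<in>multi_idx n d. (\<alpha> I)\<^sup>2 * (\<Prod>i<n. inner_w p (h (I i)) (h (I i)))) \<le>
    (\<integral>x. (hom_poly n d \<alpha> x)\<^sup>2 * weight_Rn p n x \<partial>lebesgue_Rn n)"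
proof -
  define A where "A = multi_idx n d"
  define f where "f = (\<lambda>x. \<Sum>I\<in>A. \<alpha> I * prod_poly n (\<lambda>i. monom 1 (I i)) x)"
  define g where "g = (\<lambda>x. \<Sum>I\<in>A. \<alpha> I * prod_poly n (\<lambda>i. h (I i)) x)"
  define S where "S = (\<Sum>I\<in>A. (\<alpha> I)\<^sup>2 * (\<Prod>i<n. inner_w p (h (I i)) (h (I i))))"
  have monom: "inner_w p (monom 1 k) (h k) = inner_w p (h k) (h k)" for k
  proof (cases k)
    case 0
    then obtain a where "h k = [:a:]" using h(1)[of k] by (metis degree_eq_zeroE)
    then have "h k = monom 1 k" using h(2)[of k] 0 by (simp add: monom_0)
    then show ?thesis by simp
  next
    case (Suc m)
    have "coeff (monom 1 k - h k) i = 0" if "i \<ge> k" for i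
      using that h[of k] by (cases "i = k") (auto simp: coeff_eq_0)
    then have "degree (monom 1 k - h k) \<le> m"
      using Suc by (intro degree_le) auto
    then have "inner_w p (h k) (monom 1 k - h k) = 0"
      using Suc by (intro orth) auto
    then show ?thesis by (simp add: inner_w_simps[OF p] inner_w_commute)
  qed
  have diag: "(\<Sum>I\<in>A. \<Sum>J\<in>A. \<alpha> I * \<alpha> J * (\<Prod>i<n. inner_w p (F I i) (h (J i)))) = S"
    if F: "\<And>I i. degree (F I i) = I i"
      "\<And>I i. inner_w p (F I i) (h (I i)) = inner_w p (h (I i)) (h (I i))" for F
  proof -
    have "(\<Sum>J\<in>A. \<alpha> I * \<alpha> J * (\<Prod>i<n. inner_w p (F I i) (h (J i)))) =
        (\<alpha> I)\<^sup>2 * (\<Prod>i<n. inner_w p (h (I i)) (h (I i)))" if "I \<in> A" for I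
    proof -
      have "(\<Prod>i<n. inner_w p (F I i) (h (J i))) = 0" if J: "J \<in> A - {I}" for J
      proof -
        obtain i where "i < n" "I i < J i"
          using multi_idx_neq_less[of I n d J] \<open>I \<in> A\<close> J by (auto simp: A_def)
        then have "inner_w p (F I i) (h (J i)) = 0"
          using orth[of "F I i" "J i"] F(1) by (simp add: inner_w_commute)
        with \<open>i < n\<close> show ?thesis by (intro prod_zero) auto
      qed
      then show ?thesis
        using \<open>I \<in> A\<close> finite_multi_idx[of n d, folded A_def]
        by (subst sum.remove[of A I]) (simp_all add: F(2) power2_eq_square sum.neutral del: prod_zero_iff)
    qed
    then show ?thesis unfolding S_def by (rule sum.cong[OF refl])
  qed
  note i = integrable_sum_prod_poly[OF p] and j = integral_sum_prod_poly[OF p]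
  let ?W = "weight_Rn p n" and ?L = "lebesgue_Rn n"
  have fg: "(\<integral>x. f x * g x * ?W x \<partial>?L) = S" and gg: "(\<integral>x. g x * g x * ?W x \<partial>?L) = S"
    unfolding f_def g_def using h monom by (subst j, intro diag, simp_all add: degree_monom_eq)+
  have int: "integrable ?L (\<lambda>x. f x * f x * ?W x)" "integrable ?L (\<lambda>x. f x * g x * ?W x)"
    "integrable ?L (\<lambda>x. g x * g x * ?W x)"
    unfolding f_def g_def by (rule i)+
  have "0 \<le> (\<integral>x. (f x - g x)\<^sup>2 * ?W x \<partial>?L)"
    unfolding weight_Rn_def using exp_pow_pos[of p]
    by (intro integral_nonneg_AE AE_I2 mult_nonneg_nonneg prod_nonneg) (auto simp: less_imp_le)
  also have "\<dots> = (\<integral>x. f x * f x * ?W x - 2 * (f x * g x * ?W x) + g x * g x * ?W x \<partial>?L)"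
    by (intro Bochner_Integration.integral_cong) (auto simp: power2_eq_square algebra_simps)
  also have "\<dots> = (\<integral>x. f x * f x * ?W x \<partial>?L) - 2 * S + S"
    using int fg gg by simp
  finally show ?thesis
    unfolding hom_poly_eq_prod_poly A_def[symmetric] S_def[symmetric] f_def[symmetric]
    by (simp add: f_def power2_eq_square)
qed

lemma hom_poly_weighted_lower_bound:
  "\<exists>c>0. \<forall>p\<ge>1. \<forall>n \<alpha>. mass p ^ n * (c * (second_moment p / mass p)) ^ d * coeff_sq n d \<alpha> \<le>
    (\<integral>x. (hom_poly n d \<alpha> x)\<^sup>2 * weight_Rn p n x \<partial>lebesgue_Rn n)"
proof -
  obtain c where c: "c > 0" "\<And>p k q. p \<ge> 1 \<Longrightarrow> k \<le> d \<Longrightarrow> degree q = k \<Longrightarrow> lead_coeff q = 1 \<Longrightarrow>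
     mass p * (c * (second_moment p / mass p)) ^ k \<le> inner_w p q q"
    using inner_w_monic_lower_bound[of d] by blast
  show ?thesis
  proof (intro exI[of _ c] conjI allI impI)
    fix p :: real and n and \<alpha> :: "(nat \<Rightarrow> nat) \<Rightarrow> real"
    assume p: "p \<ge> 1"
    obtain h where h: "\<And>k. degree (h k) = k" "\<And>k. lead_coeff (h k) = 1"
      "\<And>k t. degree t < k \<Longrightarrow> inner_w p (h k) t = 0"
      using exists_orthogonal_poly[OF p] by metis
    have mp: "mass p > 0" by (rule mass_pos[OF p])
    define r where "r = c * (second_moment p / mass p)"
    have r: "r \<ge> 0" using mp c second_moment_bounds(1)[OF p] by (simp add: r_def)
    have "mass p ^ n * r ^ d \<le> (\<Prod>i<n. inner_w p (h (I i)) (h (I i)))"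
      if I: "I \<in> multi_idx n d" for I
    proof -
      have sum: "(\<Sum>i<n. I i) = d" using I by (simp add: multi_idx_def)
      have "mass p ^ n * r ^ d = (\<Prod>i<n. mass p * r ^ I i)"
        using sum by (simp add: prod.distrib flip: power_sum)
      also have "\<dots> \<le> (\<Prod>i<n. inner_w p (h (I i)) (h (I i)))"
      proof (rule prod_mono, intro conjI)
        fix i assume "i \<in> {..<n}"
        then have "I i \<le> d" using sum member_le_sum[of i "{..<n}" I] by auto
        then show "mass p * r ^ I i \<le> inner_w p (h (I i)) (h (I i))"
          unfolding r_def using h by (intro c(2)[OF p]) auto
        show "0 \<le> mass p * r ^ I i" using mp r by simp
      qed
      finally show ?thesis .
    qed
    then have "mass p ^ n * r ^ d * coeff_sq n d \<alpha> \<le>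
        (\<Sum>I\<in>multi_idx n d. (\<alpha> I)\<^sup>2 * (\<Prod>i<n. inner_w p (h (I i)) (h (I i))))"
      unfolding coeff_sq_def sum_distrib_left
      by (intro sum_mono) (simp add: mult.commute mult_left_mono)
    also have "\<dots> \<le> (\<integral>x. (hom_poly n d \<alpha> x)\<^sup>2 * weight_Rn p n x \<partial>lebesgue_Rn n)"
      by (rule hom_poly_orthogonal_lower_bound[OF p h])
    finally show "mass p ^ n * (c * (second_moment p / mass p)) ^ d * coeff_sq n d \<alpha> \<le>
        (\<integral>x. (hom_poly n d \<alpha> x)\<^sup>2 * weight_Rn p n x \<partial>lebesgue_Rn n)"
      by (simp add: r_def)
  qed fact
qed

section \<open>Ratios of Gamma values\<close>

lemma ln_Gamma_slope_le:
  assumes "0 < u" "u < v" "v < (w::real)"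
  shows "(ln (Gamma v) - ln (Gamma u)) / (v - u) \<le> (ln (Gamma w) - ln (Gamma v)) / (w - v)"
proof -
  define t where "t = (v - u) / (w - u)"
  have "t * (w - u) = v - u" using assms by (simp add: t_def)
  then have "v = (1 - t) * u + t * w" by (simp add: algebra_simps)
  moreover have "0 \<le> t" "t \<le> 1" using assms by (auto simp: t_def)
  ultimately have t: "0 \<le> t" "t \<le> 1" "v = (1 - t) * u + t * w" by auto
  have "ln (Gamma v) \<le> (1 - t) * ln (Gamma u) + t * ln (Gamma w)"
    using convex_onD[OF log_convex_Gamma_real t(1,2), of u w] assms t(3) by (simp add: o_def)
  moreover have "1 - t = (w - v) / (w - u)" using assms by (simp add: t_def field_simps)
  ultimately have "ln (Gamma v) \<le> ((w - v) * ln (Gamma u) + (v - u) * ln (Gamma w)) / (w - u)"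
    using assms by (simp add: t_def add_divide_distrib)
  then have "ln (Gamma v) * (w - u) \<le> (w - v) * ln (Gamma u) + (v - u) * ln (Gamma w)"
    using assms by (simp add: pos_le_divide_eq)
  then have "(ln (Gamma v) - ln (Gamma u)) * (w - v) \<le> (ln (Gamma w) - ln (Gamma v)) * (v - u)"
    by (simp add: algebra_simps)
  then show ?thesis using assms by (simp add: frac_le_eq divide_le_eq field_simps)
qed

lemma Gamma_real_plus1: "x > 0 \<Longrightarrow> Gamma (x + 1 :: real) = x * Gamma x"
  by (rule Gamma_plus1) (auto elim!: nonpos_Ints_cases)

lemma Gamma_add_le:
  fixes x t :: real
  assumes "x > 0" "t \<ge> 0"
  shows "Gamma (x + t) \<le> Gamma x * (x + t) powr t"
proof (cases "t = 0")
  case False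
  then have t: "t > 0" using assms by simp
  have pos: "Gamma x > 0" "Gamma (x + t) > 0" using assms by (auto intro!: Gamma_real_pos)
  have "(ln (Gamma (x + t)) - ln (Gamma x)) / t \<le> ln (Gamma (x + t + 1)) - ln (Gamma (x + t))"
    using ln_Gamma_slope_le[of x "x + t" "x + t + 1"] assms t by simp
  also have "\<dots> = ln (x + t)"
    using assms pos by (subst Gamma_real_plus1) (simp_all add: ln_mult_pos)
  finally have "ln (Gamma (x + t)) \<le> ln (Gamma x * (x + t) powr t)"
    using assms t pos by (simp add: pos_divide_le_eq pos_le_divide_eq ln_mult_pos ln_powr algebra_simps)
  then show ?thesis using assms pos by (subst (asm) ln_le_cancel_iff) auto
qed (use assms in simp)

lemma Gamma_add_ge:
  fixes x t :: real
  assumes "x > 0" "t \<ge> 0"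
  shows "Gamma (x + 1) * x powr t \<le> Gamma (x + 1 + t)"
proof (cases "t = 0")
  case False
  then have t: "t > 0" using assms by simp
  have pos: "Gamma x > 0" "Gamma (x + 1) > 0" "Gamma (x + 1 + t) > 0"
    using assms by (auto intro!: Gamma_real_pos)
  have "ln x = ln (Gamma (x + 1)) - ln (Gamma x)"
    using assms pos by (subst Gamma_real_plus1) (simp_all add: ln_mult_pos)
  also have "\<dots> \<le> (ln (Gamma (x + 1 + t)) - ln (Gamma (x + 1))) / t"
    using ln_Gamma_slope_le[of x "x + 1" "x + 1 + t"] assms t by simp
  finally have "ln (Gamma (x + 1) * x powr t) \<le> ln (Gamma (x + 1 + t))"
    using assms t pos by (simp add: pos_divide_le_eq pos_le_divide_eq ln_mult_pos ln_powr algebra_simps)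
  then show ?thesis using assms pos by (subst (asm) ln_le_cancel_iff) auto
qed (use assms in simp)

text \<open>A reverse of the log-convexity inequality
  \<open>\<Gamma>(a+1+2s)\<^sup>d \<le> \<Gamma>(a+1)\<^sup>d\<^sup>-\<^sup>1 \<Gamma>(a+1+2ds)\<close>; since \<open>s\<close> may tend to \<open>0\<close> together
  with \<open>a\<close>, it relies on \<open>(1 + 1/s) powr s\<close> being bounded.\<close>
lemma Gamma_reverse_log_convex:
  fixes a s :: real and d :: nat
  assumes s: "0 < s" "s \<le> 1" "s \<le> a"
  shows "Gamma (a + 1 + 2 * d * s) / Gamma (a + 1) \<le>
    ((1 + 2 * d) * exp 1) ^ (2 * d) * (Gamma (a + 1 + 2 * s) / Gamma (a + 1)) ^ d"
proof -
  have a: "a > 0" using s by simp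
  have G: "Gamma (a + 1) > 0" using a by (intro Gamma_real_pos) simp
  define D :: real where "D = 1 + 2 * d"
  have D: "D \<ge> 1" by (simp add: D_def)
  have "(1 + 1 / s) powr s = exp (s * ln (1 + 1 / s))"
    using s add_pos_pos[of 1 "1 / s"] by (simp add: powr_def)
  also have "s * ln (1 + 1 / s) \<le> s * (1 / s)"
    using s by (intro mult_left_mono ln_add_one_self_le_self) auto
  finally have e: "(1 + 1 / s) powr s \<le> exp 1" using s by simp
  have "(a + 1 + 2 * d * s) / a = 1 + 1 / a + 2 * d * (s / a)"
    using a by (simp add: field_simps)
  also have "\<dots> \<le> 1 + 1 / s + 2 * d * 1"
    using s a mult_left_mono[of "s / a" 1 "2 * real d"] frac_le[of 1 1 s a] by simp
  also have "\<dots> \<le> D * (1 + 1 / s)"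
    using s by (simp add: D_def field_simps)
  finally have q: "a + 1 + 2 * d * s \<le> a * (D * (1 + 1 / s))"
    using a by (simp add: field_simps)
  have "Gamma (a + 1 + 2 * d * s) / Gamma (a + 1) \<le> (a + 1 + 2 * d * s) powr (2 * d * s)"
    using Gamma_add_le[of "a + 1" "2 * d * s"] a s G by (simp add: field_simps)
  also have "\<dots> \<le> (a * (D * (1 + 1 / s))) powr (2 * d * s)"
    using q a s by (intro powr_mono2) auto
  also have "\<dots> = a powr (2 * d * s) * (D powr s * (1 + 1 / s) powr s) powr (2 * d)"
    using a s D by (simp add: powr_mult powr_powr mult_ac)
  also have "\<dots> \<le> a powr (2 * d * s) * (D * exp 1) powr (2 * d)"
  proof (intro mult_left_mono powr_mono2 mult_mono e)
    show "D powr s \<le> D" using powr_mono[of s 1 D] s D by simp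
  qed (use D in auto)
  also have "(D * exp 1) powr (2 * d) = (D * exp 1) ^ (2 * d)"
    using D powr_realpow[of "D * exp 1" "2 * d"] by simp
  also have "a powr (2 * d * s) = (a powr (2 * s)) ^ d"
    using a by (simp add: powr_powr mult_ac flip: powr_realpow)
  also have "(a powr (2 * s)) ^ d \<le> (Gamma (a + 1 + 2 * s) / Gamma (a + 1)) ^ d"
    using Gamma_add_ge[of a "2 * s"] a s G by (intro power_mono) (simp_all add: field_simps)
  finally show ?thesis using D by (simp add: D_def mult_ac)
qed

section \<open>Homogeneous functions on the ball\<close>

lemma sets_lebesgue_Rn: "sets (lebesgue_Rn n) = sets (\<Pi>\<^sub>M i\<in>{..<n}. borel)"
  unfolding lebesgue_Rn_def by (intro sets_PiM_cong) auto

lemma space_lebesgue_Rn: "space (lebesgue_Rn n) = (\<Pi>\<^sub>E i\<in>{..<n}. UNIV)"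
  by (simp add: lebesgue_Rn_def space_PiM)

lemma component_measurable_lebesgue_Rn [measurable]:
  "i < n \<Longrightarrow> (\<lambda>x. x i) \<in> borel_measurable (lebesgue_Rn n)"
  unfolding lebesgue_Rn_def by (simp add: measurable_component_singleton)

interpretation lebesgue_Rn: sigma_finite_measure "lebesgue_Rn n" for n
  unfolding lebesgue_Rn_def by (rule lborel_product.sigma_finite) simp

lemma weight_Rn_measurable [measurable]: "weight_Rn p n \<in> borel_measurable (lebesgue_Rn n)"
  unfolding weight_Rn_def by measurable

lemma hom_poly_measurable [measurable]: "hom_poly n d \<alpha> \<in> borel_measurable (lebesgue_Rn n)"
  unfolding hom_poly_def by measurable

lemma lp_norm_measurable [measurable]: "lp_norm p n \<in> borel_measurable (lebesgue_Rn n)"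
  unfolding lp_norm_def by measurable

lemma scaled_lp_ball_sets [measurable]: "scaled_lp_ball p n z \<in> sets (lebesgue_Rn n)"
  unfolding scaled_lp_ball_def by measurable

definition scale_Rn :: "nat \<Rightarrow> real \<Rightarrow> (nat \<Rightarrow> real) \<Rightarrow> nat \<Rightarrow> real" where
  "scale_Rn n c x = (\<lambda>i\<in>{..<n}. c * x i)"

lemma scale_Rn_measurable [measurable]:
  "scale_Rn n c \<in> measurable (lebesgue_Rn n) (lebesgue_Rn n)"
proof -
  have "(\<lambda>x. \<lambda>i\<in>{..<n}. c * x i) \<in> measurable (lebesgue_Rn n) (\<Pi>\<^sub>M i\<in>{..<n}. borel)"
    by (intro measurable_restrict) simp
  then show ?thesis
    unfolding scale_Rn_def by (subst measurable_cong_sets[OF refl sets_lebesgue_Rn])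
qed

lemma nn_integral_scale_Rn:
  assumes c: "c > 0" and g [measurable]: "g \<in> borel_measurable (lebesgue_Rn n)"
  shows "(\<integral>\<^sup>+x. g x \<partial>lebesgue_Rn n) = ennreal (c ^ n) * (\<integral>\<^sup>+x. g (scale_Rn n c x) \<partial>lebesgue_Rn n)"
proof -
  define P where "P = density (distr (lebesgue_Rn n) (lebesgue_Rn n) (scale_Rn n c)) (\<lambda>_. ennreal (c ^ n))"
  have "P = (\<Pi>\<^sub>M i\<in>{..<n}. lborel)"
  proof (rule lborel_product.PiM_eqI)
    show "sets P = sets (\<Pi>\<^sub>M i\<in>{..<n}. lborel)" by (simp add: P_def lebesgue_Rn_def)
    fix A :: "nat \<Rightarrow> real set"
    assume A: "\<And>i. i \<in> {..<n} \<Longrightarrow> A i \<in> sets lborel"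
    have box: "Pi\<^sub>E {..<n} A \<in> sets (lebesgue_Rn n)"
      unfolding lebesgue_Rn_def using A by (intro sets_PiM_I_finite) auto
    have vimage: "(\<lambda>y. c * y) -` A i \<in> sets lborel" if "i < n" for i
      using measurable_sets[of "\<lambda>y. c * y" borel borel "A i"] A[of i] that by simp
    have one: "ennreal c * emeasure lborel ((\<lambda>y. c * y) -` A i) = emeasure lborel (A i)" if "i < n" for i
    proof -
      have Ai: "A i \<in> sets borel" using A that by simp
      have "emeasure lborel (A i) = (\<integral>\<^sup>+y. indicator (A i) y \<partial>lborel)"
        using Ai by simp
      also have "\<dots> = ennreal c * (\<integral>\<^sup>+y. indicator (A i) (0 + c * y) \<partial>lborel)"
        using nn_integral_real_affine[of "indicator (A i)" c 0] c Ai by simp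
      also have "(\<integral>\<^sup>+y. indicator (A i) (0 + c * y) \<partial>lborel) =
          (\<integral>\<^sup>+y. indicator ((\<lambda>y. c * y) -` A i) y \<partial>lborel)"
        by (intro nn_integral_cong) (simp add: indicator_def)
      also have "\<dots> = emeasure lborel ((\<lambda>y. c * y) -` A i)"
        using vimage[OF that] by simp
      finally show ?thesis by simp
    qed
    have "scale_Rn n c -` Pi\<^sub>E {..<n} A \<inter> space (lebesgue_Rn n) =
        (\<Pi>\<^sub>E i\<in>{..<n}. (\<lambda>y. c * y) -` A i)"
      by (auto simp: scale_Rn_def space_lebesgue_Rn PiE_iff extensional_def)
    then have "emeasure P (Pi\<^sub>E {..<n} A) =
        ennreal (c ^ n) * emeasure (lebesgue_Rn n) (\<Pi>\<^sub>E i\<in>{..<n}. (\<lambda>y. c * y) -` A i)"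
      using box by (simp add: P_def emeasure_density nn_integral_cmult_indicator emeasure_distr)
    also have "emeasure (lebesgue_Rn n) (\<Pi>\<^sub>E i\<in>{..<n}. (\<lambda>y. c * y) -` A i) =
        (\<Prod>i<n. emeasure lborel ((\<lambda>y. c * y) -` A i))"
      unfolding lebesgue_Rn_def using vimage by (intro lborel_product.emeasure_PiM) auto
    also have "ennreal (c ^ n) = (\<Prod>i<n. ennreal c)"
      using c by (simp add: ennreal_power)
    also have "(\<Prod>i<n. ennreal c) * (\<Prod>i<n. emeasure lborel ((\<lambda>y. c * y) -` A i)) =
        (\<Prod>i<n. emeasure lborel (A i))"
      unfolding prod.distrib[symmetric] using one by (intro prod.cong) auto
    finally show "emeasure P (Pi\<^sub>E {..<n} A) = (\<Prod>i\<in>{..<n}. emeasure lborel (A i))" .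
  qed simp
  then have "(\<integral>\<^sup>+x. g x \<partial>lebesgue_Rn n) = (\<integral>\<^sup>+x. g x \<partial>P)"
    by (simp add: lebesgue_Rn_def)
  also have "\<dots> = (\<integral>\<^sup>+x. ennreal (c ^ n) * g x \<partial>distr (lebesgue_Rn n) (lebesgue_Rn n) (scale_Rn n c))"
    unfolding P_def by (subst nn_integral_density) simp_all
  also have "\<dots> = ennreal (c ^ n) * (\<integral>\<^sup>+x. g (scale_Rn n c x) \<partial>lebesgue_Rn n)"
    by (subst nn_integral_distr) (simp_all add: nn_integral_cmult)
  finally show ?thesis .
qed

lemma lp_norm_scale_Rn:
  assumes "c > 0" "p > 0"
  shows "lp_norm p n (scale_Rn n c x) = c * lp_norm p n x"
proof -
  have "(\<Sum>i<n. \<bar>scale_Rn n c x i\<bar> powr p) = c powr p * (\<Sum>i<n. \<bar>x i\<bar> powr p)"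
    using assms by (simp add: scale_Rn_def abs_mult powr_mult sum_distrib_left)
  then show ?thesis
    using assms by (simp add: lp_norm_def powr_mult powr_powr sum_nonneg)
qed

lemma lp_norm_le_iff:
  assumes "z > 0" "p > 0"
  shows "lp_norm p n x \<le> z \<longleftrightarrow> (\<Sum>i<n. \<bar>x i\<bar> powr p) \<le> z powr p"
proof -
  let ?S = "\<Sum>i<n. \<bar>x i\<bar> powr p"
  have "?S \<ge> 0" by (simp add: sum_nonneg)
  then have "?S = (?S powr (1 / p)) powr p" using assms by (simp add: powr_powr)
  moreover have "(?S powr (1 / p)) powr p \<le> z powr p \<longleftrightarrow> ?S powr (1 / p) \<le> z"
    using assms powr_mono2[of p "?S powr (1 / p)" z] powr_less_mono2[of p z "?S powr (1 / p)"]
    by (meson less_imp_le not_le powr_ge_zero)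
  ultimately show ?thesis by (simp add: lp_norm_def)
qed

definition homogeneous_Rn :: "nat \<Rightarrow> nat \<Rightarrow> ((nat \<Rightarrow> real) \<Rightarrow> real) \<Rightarrow> bool" where
  "homogeneous_Rn n m G \<longleftrightarrow> (\<forall>c>0. \<forall>x. G (scale_Rn n c x) = c ^ m * G x)"

lemma nn_integral_homogeneous_ball:
  assumes p: "p > 0" and z: "z > 0"
    and G [measurable]: "G \<in> borel_measurable (lebesgue_Rn n)"
    and hom: "homogeneous_Rn n m G"
  shows "(\<integral>\<^sup>+x. ennreal (G x) * indicator (scaled_lp_ball p n z) x \<partial>lebesgue_Rn n) =
    ennreal (z ^ (n + m)) * (\<integral>\<^sup>+x. ennreal (G x) * indicator (scaled_lp_ball p n 1) x \<partial>lebesgue_Rn n)"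
proof -
  have "ennreal (G (scale_Rn n z x)) * indicator (scaled_lp_ball p n z) (scale_Rn n z x) =
      ennreal (z ^ m) * (ennreal (G x) * indicator (scaled_lp_ball p n 1) x)"
    if "x \<in> space (lebesgue_Rn n)" for x
  proof -
    have "scale_Rn n z x \<in> space (lebesgue_Rn n)"
      by (simp add: scale_Rn_def space_lebesgue_Rn)
    then have "indicator (scaled_lp_ball p n z) (scale_Rn n z x) =
        (indicator (scaled_lp_ball p n 1) x :: ennreal)"
      using that z by (simp add: scaled_lp_ball_def lp_norm_scale_Rn[OF z p] indicator_def)
    then show ?thesis
      using hom z by (simp add: homogeneous_Rn_def ennreal_mult' mult.assoc)
  qed
  then have "(\<integral>\<^sup>+x. ennreal (G x) * indicator (scaled_lp_ball p n z) x \<partial>lebesgue_Rn n) =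
      ennreal (z ^ n) * (\<integral>\<^sup>+x. ennreal (z ^ m) * (ennreal (G x) * indicator (scaled_lp_ball p n 1) x) \<partial>lebesgue_Rn n)"
    using z by (subst nn_integral_scale_Rn[OF z]) (auto cong: nn_integral_cong)
  also have "\<dots> = ennreal (z ^ n) * (ennreal (z ^ m) *
      (\<integral>\<^sup>+x. ennreal (G x) * indicator (scaled_lp_ball p n 1) x \<partial>lebesgue_Rn n))"
    by (subst nn_integral_cmult) auto
  finally show ?thesis
    using z by (simp add: power_add ennreal_mult' mult.assoc)
qed

lemma nn_integral_exp_Ici:
  "(\<integral>\<^sup>+s. ennreal (exp (- s)) * indicator {t::real..} s \<partial>lborel) = ennreal (exp (- t))"
proof -
  have "((\<lambda>s::real. - exp (- s)) \<longlongrightarrow> - 0) at_top"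
    by (intro tendsto_minus filterlim_compose[OF exp_at_bot] filterlim_uminus_at_bot_at_top)
  then have "(\<integral>\<^sup>+s. ennreal (exp (- s)) * indicator {t::real..} s \<partial>lborel) = ennreal (0 - (- exp (- t)))"
    by (intro nn_integral_FTC_atLeast) (auto intro!: derivative_eq_intros)
  then show ?thesis by simp
qed

text \<open>Layer cake: \<open>exp (-S) = \<integral>\<^sub>S\<^sup>\<infinity> exp (-s) ds\<close>, and the sublevel sets of
  \<open>S = \<Sum>\<bar>x\<^sub>i\<bar>\<^sup>p\<close> are the balls of radius \<open>s powr (1/p)\<close>.\<close>
lemma nn_integral_homogeneous_weight:
  assumes p: "p > 0"
    and G [measurable]: "G \<in> borel_measurable (lebesgue_Rn n)" and G0: "\<And>x. G x \<ge> 0"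
    and hom: "homogeneous_Rn n m G"
  shows "(\<integral>\<^sup>+x. ennreal (G x * weight_Rn p n x) \<partial>lebesgue_Rn n) =
    ennreal (Gamma (real (n + m) / p + 1)) *
      (\<integral>\<^sup>+x. ennreal (G x) * indicator (scaled_lp_ball p n 1) x \<partial>lebesgue_Rn n)"
proof -
  let ?L = "lebesgue_Rn n"
  define J where "J = (\<integral>\<^sup>+x. ennreal (G x) * indicator (scaled_lp_ball p n 1) x \<partial>?L)"
  define S where "S = (\<lambda>x. \<Sum>i<n. \<bar>x i\<bar> powr p)"
  have S [measurable]: "S \<in> borel_measurable ?L" unfolding S_def by measurable
  have W: "weight_Rn p n x = exp (- S x)" for x
    by (simp add: weight_Rn_def exp_pow_def S_def exp_sum flip: sum_negf)
  interpret pair_sigma_finite ?L "lborel :: real measure" ..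
  have "(\<integral>\<^sup>+x. ennreal (G x * weight_Rn p n x) \<partial>?L) =
      (\<integral>\<^sup>+x. (\<integral>\<^sup>+s. ennreal (G x) * (ennreal (exp (- s)) * indicator {S x..} s) \<partial>lborel) \<partial>?L)"
    using G0 by (intro nn_integral_cong) (subst nn_integral_cmult, simp_all add: W nn_integral_exp_Ici ennreal_mult)
  also have "\<dots> = (\<integral>\<^sup>+x. (\<integral>\<^sup>+s. ennreal (G x) * (ennreal (exp (- s)) * of_bool (S x \<le> s)) \<partial>lborel) \<partial>?L)"
    by (intro nn_integral_cong) (simp add: indicator_def)
  also have "\<dots> = (\<integral>\<^sup>+s. (\<integral>\<^sup>+x. ennreal (G x) * (ennreal (exp (- s)) * of_bool (S x \<le> s)) \<partial>?L) \<partial>lborel)"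
    by (rule Fubini'[symmetric]) measurable
  also have "\<dots> = (\<integral>\<^sup>+s. ennreal (indicator {0..} s * s powr (real (n + m) / p + 1 - 1) / exp s) * J \<partial>lborel)"
  proof (rule nn_integral_cong_AE)
    have "(\<integral>\<^sup>+x. ennreal (G x) * (ennreal (exp (- s)) * of_bool (S x \<le> s)) \<partial>?L) =
        ennreal (indicator {0..} s * s powr (real (n + m) / p + 1 - 1) / exp s) * J" if "s \<noteq> 0" for s
    proof (cases "s > 0")
      case False
      then have "\<not> S x \<le> s" for x
        using that sum_nonneg[of "{..<n}" "\<lambda>i. \<bar>x i\<bar> powr p"] by (simp add: S_def)
      then show ?thesis using False that by simp
    next
      case True
      define t where "t = s powr (1 / p)"
      have t: "t > 0" "t powr p = s" using True p by (auto simp: t_def powr_powr)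
      have "t ^ (n + m) = s powr (real (n + m) / p)"
        using t(1) True powr_realpow[OF t(1), of "n + m"] by (simp add: t_def powr_powr)
      have "(\<integral>\<^sup>+x. ennreal (G x) * (ennreal (exp (- s)) * of_bool (S x \<le> s)) \<partial>?L) =
          (\<integral>\<^sup>+x. ennreal (exp (- s)) * (ennreal (G x) * indicator (scaled_lp_ball p n t) x) \<partial>?L)"
        using lp_norm_le_iff[OF t(1) p] t(2)
        by (intro nn_integral_cong) (simp add: scaled_lp_ball_def S_def indicator_def mult.commute)
      also have "\<dots> = ennreal (exp (- s)) * (ennreal (t ^ (n + m)) * J)"
        unfolding J_def nn_integral_homogeneous_ball[OF p t(1) G hom, symmetric]
        by (rule nn_integral_cmult) measurable
      also have "\<dots> = ennreal (indicator {0..} s * s powr (real (n + m) / p + 1 - 1) / exp s) * J"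
        using True \<open>t ^ (n + m) = _\<close>
        by (simp add: exp_minus divide_inverse mult_ac flip: ennreal_mult' mult.assoc)
      finally show ?thesis .
    qed
    then show "AE s in lborel. (\<integral>\<^sup>+x. ennreal (G x) * (ennreal (exp (- s)) * of_bool (S x \<le> s)) \<partial>?L) =
        ennreal (indicator {0..} s * s powr (real (n + m) / p + 1 - 1) / exp s) * J"
      using AE_lborel_singleton[of "0::real"] by auto
  qed
  also have "\<dots> = ennreal (Gamma (real (n + m) / p + 1)) * J"
    using p by (subst nn_integral_multc, simp, subst Gamma_conv_nn_integral_real)
      (simp_all add: add_nonneg_pos)
  finally show ?thesis by (simp add: J_def)
qed

lemma integral_weight_Rn:
  assumes "p \<ge> 1"
  shows "integrable (lebesgue_Rn n) (weight_Rn p n)"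
    "(\<integral>x. weight_Rn p n x \<partial>lebesgue_Rn n) = mass p ^ n"
  using integrable_prod_poly[OF assms, of n "\<lambda>_. 1" "\<lambda>_. 1"]
    integral_prod_poly[OF assms, of n "\<lambda>_. 1" "\<lambda>_. 1"]
  by (simp_all add: prod_poly_def inner_w_def mass_def)

lemma weight_Rn_pos: "weight_Rn p n x > 0"
  by (simp add: weight_Rn_def prod_pos exp_pow_pos)

lemma integral_unif_ball_homogeneous:
  assumes p: "p \<ge> 1" and z: "z > 0"
    and G [measurable]: "G \<in> borel_measurable (lebesgue_Rn n)" and G0: "\<And>x. G x \<ge> 0"
    and hom: "homogeneous_Rn n m G"
    and int: "integrable (lebesgue_Rn n) (\<lambda>x. G x * weight_Rn p n x)"
  shows "(\<integral>x. G x \<partial>unif_ball p n z) =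
    z ^ m * Gamma (n / p + 1) / Gamma (real (n + m) / p + 1) *
      (\<integral>x. G x * weight_Rn p n x \<partial>lebesgue_Rn n) / mass p ^ n"
proof -
  let ?L = "lebesgue_Rn n"
  have p0: "p > 0" using p by simp
  have ball: "(\<integral>\<^sup>+x. ennreal (H x) * indicator (scaled_lp_ball p n z) x \<partial>?L) =
      ennreal (z ^ (n + k) * (\<integral>x. H x * weight_Rn p n x \<partial>?L) / Gamma (real (n + k) / p + 1))"
    if H: "H \<in> borel_measurable ?L" "\<And>x. H x \<ge> 0" "homogeneous_Rn n k H"
      "integrable ?L (\<lambda>x. H x * weight_Rn p n x)" for H k
  proof -
    define J where "J = (\<integral>\<^sup>+x. ennreal (H x) * indicator (scaled_lp_ball p n 1) x \<partial>?L)"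
    define \<Gamma> where "\<Gamma> = Gamma (real (n + k) / p + 1)"
    have \<Gamma>: "\<Gamma> > 0" unfolding \<Gamma>_def using p by (intro Gamma_real_pos) (simp add: add_nonneg_pos)
    have "ennreal \<Gamma> * J = (\<integral>\<^sup>+x. ennreal (H x * weight_Rn p n x) \<partial>?L)"
      unfolding J_def \<Gamma>_def nn_integral_homogeneous_weight[OF p0 H(1-3)] ..
    also have "\<dots> = ennreal (\<integral>x. H x * weight_Rn p n x \<partial>?L)"
      using H(2) weight_Rn_pos[of p n] by (intro nn_integral_eq_integral[OF H(4)]) (simp add: less_imp_le)
    finally have "ennreal (1 / \<Gamma>) * (ennreal \<Gamma> * J) = ennreal (1 / \<Gamma>) * ennreal (\<integral>x. H x * weight_Rn p n x \<partial>?L)"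
      by simp
    then have "J = ennreal ((\<integral>x. H x * weight_Rn p n x \<partial>?L) / \<Gamma>)"
      using \<Gamma> by (simp flip: ennreal_mult' mult.assoc)
    then show ?thesis
      unfolding nn_integral_homogeneous_ball[OF p0 z H(1,3)] J_def[symmetric] \<Gamma>_def[symmetric]
      using z by (simp flip: ennreal_mult')
  qed
  have mp: "mass p > 0" by (rule mass_pos[OF p])
  have \<Gamma>: "Gamma (n / p + 1) > 0" "Gamma (real (n + m) / p + 1) > 0"
    using p by (auto intro!: Gamma_real_pos add_nonneg_pos)
  define v where "v = z ^ n * mass p ^ n / Gamma (n / p + 1)"
  have v: "v > 0" using z mp \<Gamma> by (simp add: v_def)
  have "emeasure ?L (scaled_lp_ball p n z) = ennreal v"
    using ball[of "\<lambda>_. 1" 0] integral_weight_Rn[OF p, of n]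
    by (simp add: homogeneous_Rn_def v_def)
  moreover have "(\<integral>\<^sup>+x. ennreal (G x) \<partial>unif_ball p n z) =
      (\<integral>\<^sup>+x. ennreal (G x) * indicator (scaled_lp_ball p n z) x \<partial>?L) / emeasure ?L (scaled_lp_ball p n z)"
    unfolding unif_ball_def by (rule nn_integral_uniform_measure) measurable
  moreover define I where "I = (\<integral>x. G x * weight_Rn p n x \<partial>?L)"
  moreover have "I \<ge> 0" unfolding I_def using G0 weight_Rn_pos[of p n]
    by (intro integral_nonneg_AE AE_I2) (simp add: less_imp_le)
  ultimately have nn: "(\<integral>\<^sup>+x. ennreal (G x) \<partial>unif_ball p n z) =
      ennreal (z ^ (n + m) * I / Gamma (real (n + m) / p + 1) / v)"
    using ball[OF G G0 hom int] v z \<Gamma> by (simp add: divide_ennreal)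
  have "(\<integral>x. G x \<partial>unif_ball p n z) = enn2real (\<integral>\<^sup>+x. ennreal (G x) \<partial>unif_ball p n z)"
    using G0 by (intro integral_eq_nn_integral) (simp_all add: unif_ball_def)
  also have "\<dots> = z ^ (n + m) * I / Gamma (real (n + m) / p + 1) / v"
    unfolding nn using \<open>I \<ge> 0\<close> v z \<Gamma> by (intro enn2real_ennreal) simp
  also have "\<dots> = z ^ m * Gamma (n / p + 1) / Gamma (real (n + m) / p + 1) * I / mass p ^ n"
    using z by (simp add: v_def power_add)
  finally show ?thesis unfolding I_def .
qed

lemma homogeneous_hom_poly_square: "homogeneous_Rn n (2 * d) (\<lambda>x. (hom_poly n d \<alpha> x)\<^sup>2)"
proof -
  have "hom_poly n d \<alpha> (scale_Rn n c x) = c ^ d * hom_poly n d \<alpha> x" for c x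
  proof -
    have "(\<Prod>i<n. scale_Rn n c x i ^ I i) = c ^ d * (\<Prod>i<n. x i ^ I i)" if "I \<in> multi_idx n d" for I
      using that by (simp add: scale_Rn_def power_mult_distrib prod.distrib multi_idx_def flip: power_sum)
    then show ?thesis
      unfolding hom_poly_def sum_distrib_left by (intro sum.cong) (simp_all add: mult_ac)
  qed
  then show ?thesis
    by (simp add: homogeneous_Rn_def power_mult_distrib mult.commute[of 2] flip: power_mult)
qed

lemma
  assumes p: "p \<ge> 1" and n: "n \<ge> 1"
  shows integrable_component_square: "integrable (lebesgue_Rn n) (\<lambda>x. (x 0)\<^sup>2 * weight_Rn p n x)"
    and integral_component_square:
      "(\<integral>x. (x 0)\<^sup>2 * weight_Rn p n x \<partial>lebesgue_Rn n) = second_moment p / mass p * mass p ^ n"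
proof -
  define F :: "nat \<Rightarrow> real poly" where "F = (\<lambda>i. if i = 0 then [:0, 1:] else 1)"
  have split: "(\<Prod>i<n. f i) = f 0 * (\<Prod>i\<in>{..<n} - {0}. f i)" for f :: "nat \<Rightarrow> real"
    using n by (intro prod.remove) auto
  have x0: "(x 0)\<^sup>2 = prod_poly n F x * prod_poly n F x" for x
    by (simp add: prod_poly_def split F_def power2_eq_square)
  have mp: "mass p > 0" by (rule mass_pos[OF p])
  have "(\<Prod>i<n. inner_w p (F i) (F i)) = second_moment p * mass p ^ (n - 1)"
    using n by (simp add: split F_def inner_w_def second_moment_def mass_def power2_eq_square)
  also have "\<dots> = second_moment p / mass p * mass p ^ n"
    using mp n by (simp add: power_eq_if)
  finally show "(\<integral>x. (x 0)\<^sup>2 * weight_Rn p n x \<partial>lebesgue_Rn n) = second_moment p / mass p * mass p ^ n"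
    unfolding x0 by (simp only: integral_prod_poly[OF p])
  show "integrable (lebesgue_Rn n) (\<lambda>x. (x 0)\<^sup>2 * weight_Rn p n x)"
    unfolding x0 by (rule integrable_prod_poly[OF p])
qed

theorem theorem2p2:
  fixes d :: nat
  shows "\<exists>C>0. \<forall>(p::real) (n::nat) (z::real) (\<alpha>::(nat \<Rightarrow> nat) \<Rightarrow> real).
           p \<ge> 1 \<longrightarrow> n \<ge> 1 \<longrightarrow> z > 0 \<longrightarrow> isotropic n (unif_ball p n z) \<longrightarrow>
           (\<integral>x. (hom_poly n d \<alpha> x)\<^sup>2 \<partial>(unif_ball p n z)) \<ge> C * coeff_sq n d \<alpha>"
proof -
  obtain c where c: "c > 0" "\<And>p n \<alpha>. p \<ge> 1 \<Longrightarrow>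
      mass p ^ n * (c * (second_moment p / mass p)) ^ d * coeff_sq n d \<alpha> \<le>
      (\<integral>x. (hom_poly n d \<alpha> x)\<^sup>2 * weight_Rn p n x \<partial>lebesgue_Rn n)"
    using hom_poly_weighted_lower_bound[of d] by blast
  define K :: real where "K = ((1 + 2 * d) * exp 1) ^ (2 * d)"
  have K: "K > 0" by (simp add: K_def add_pos_nonneg)
  show ?thesis
  proof (intro exI[of _ "c ^ d / K"] conjI allI impI)
    fix p z :: real and n :: nat and \<alpha> :: "(nat \<Rightarrow> nat) \<Rightarrow> real"
    assume p: "p \<ge> 1" and n: "n \<ge> 1" and z: "z > 0" and iso: "isotropic n (unif_ball p n z)"
    define v where "v = second_moment p / mass p"
    define G0 where "G0 = Gamma (n / p + 1)"
    define G1 where "G1 = Gamma (n / p + 1 + 2 * (1 / p))"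
    define Gd where "Gd = Gamma (n / p + 1 + 2 * d * (1 / p))"
    define Q where "Q = (\<integral>x. (hom_poly n d \<alpha> x)\<^sup>2 * weight_Rn p n x \<partial>lebesgue_Rn n)"
    have mp: "mass p > 0" by (rule mass_pos[OF p])
    have G: "G0 > 0" "G1 > 0" "Gd > 0"
      unfolding G0_def G1_def Gd_def using p by (intro Gamma_real_pos add_nonneg_pos add_pos_nonneg; simp)+
    have Gd: "Gd / G0 \<le> K * (G1 / G0) ^ d"
      unfolding Gd_def G0_def G1_def K_def
      using p n Gamma_reverse_log_convex[of "1 / p" "n / p" d] by (simp add: divide_right_mono)
    have "1 = (\<integral>x. (x 0)\<^sup>2 \<partial>unif_ball p n z)"
      using iso n by (auto simp: isotropic_def power2_eq_square)
    also have "\<dots> = z ^ 2 * Gamma (n / p + 1) / Gamma (real (n + 2) / p + 1) *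
        (\<integral>x. (x 0)\<^sup>2 * weight_Rn p n x \<partial>lebesgue_Rn n) / mass p ^ n"
      using n integrable_component_square[OF p n]
      by (intro integral_unif_ball_homogeneous[OF p z])
        (auto simp: homogeneous_Rn_def scale_Rn_def power_mult_distrib)
    also have "Gamma (real (n + 2) / p + 1) = G1"
      unfolding G1_def by (simp add: add_divide_distrib add_ac)
    also have "z ^ 2 * Gamma (n / p + 1) / G1 *
        (\<integral>x. (x 0)\<^sup>2 * weight_Rn p n x \<partial>lebesgue_Rn n) / mass p ^ n = z\<^sup>2 * (G0 * v) / G1"
      using mp by (simp add: integral_component_square[OF p n] v_def G0_def)
    finally have v: "G1 / G0 = z\<^sup>2 * v"
      using G by (simp add: field_simps)
    have "c ^ d / K * coeff_sq n d \<alpha> = c ^ d * (G1 / G0) ^ d * coeff_sq n d \<alpha> / (K * (G1 / G0) ^ d)"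
      using G by simp
    also have "\<dots> \<le> c ^ d * (G1 / G0) ^ d * coeff_sq n d \<alpha> / (Gd / G0)"
      using c G K Gd
      by (intro divide_left_mono mult_nonneg_nonneg mult_pos_pos) (auto simp: coeff_sq_def sum_nonneg)
    also have "\<dots> = z ^ (2 * d) * (G0 / Gd) * (mass p ^ n * (c * v) ^ d * coeff_sq n d \<alpha>) / mass p ^ n"
      using mp by (simp add: v power_mult_distrib power_mult)
    also have "\<dots> \<le> z ^ (2 * d) * (G0 / Gd) * Q / mass p ^ n"
      using mp z G c(2)[OF p] unfolding v_def Q_def
      by (intro divide_right_mono mult_left_mono) auto
    also have "\<dots> = z ^ (2 * d) * Gamma (n / p + 1) / Gamma (real (n + 2 * d) / p + 1) * Q / mass p ^ n"
      by (simp add: G0_def Gd_def add_divide_distrib add_ac)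
    also have "\<dots> = (\<integral>x. (hom_poly n d \<alpha> x)\<^sup>2 \<partial>unif_ball p n z)"
      unfolding Q_def
      using integral_unif_ball_homogeneous[OF p z _ _ homogeneous_hom_poly_square
          integrable_hom_poly_square[OF p], of n d \<alpha>] by simp
    finally show "c ^ d / K * coeff_sq n d \<alpha> \<le> (\<integral>x. (hom_poly n d \<alpha> x)\<^sup>2 \<partial>unif_ball p n z)" .
  qed (use c K in simp)
qed

end
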